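(* Let $0<p<1$ and let $P=pP_1+(1-p)P_2$, where $P_1$ and $P_2$ are the uniform distributions on $[0,1]$ and $[1,2]$. Let $n\ge 3$, and let $\alpha_n$ be an optimal set of $n$-means for $P$ containing elements from both $[0,1]$ and $(1,2]$, with $\alpha_n\cap[0,1]=\{a_1<a_2<\cdots<a_k\}$ and $\alpha_n\cap(1,2]=\{b_1<\cdots<b_m\}$, $k+m=n$. Suppose $k\geq 2$ and $m=1$. If $\frac12(a_k+b_1)\leq 1$, then $a_j=\frac{(2j-1)(a_k+b_1)}{4k}$ for $1\leq j\leq k$, and $b_1=E(X : X\in[\frac12(a_k+b_1),2])$, and the $n$th quantization error is \[V1(k,1)=p\frac{(a_k+b_1)^3}{96k^2}+p\int_{\frac12(a_k+b_1)}^{1}(x-b_1)^2\,dx+(1-p)\int_1^2(x-b_1)^2\,dx.\] If $1\leq\frac12(a_k+b_1)$, then $a_j=\frac{(2j-1)(a_{k-1}+a_k)}{4(k-1)}$ for $1\leq j\leq k-1$, $a_k=E(X : X\in[\frac12(a_{k-1}+a_k),\frac12(a_k+b_1)])$, and $b_1=E(X : X\in[\frac12(a_k+b_1),2])$, and the $n$th quantization error is \[V2(k,1)=p\frac{(a_{k-1}+a_k)^3}{96(k-1)^2}+p\int_{\frac12(a_{k-1}+a_k)}^{1}(x-a_k)^2\,dx+(1-p)\int_1^{\frac12(a_k+b_1)}(x-a_k)^2\,dx+(1-p)\int_{\frac12(a_k+b_1)}^{2}(x-b_1)^2\,dx.\]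
   Context: For a Borel probability measure $P$ on $\mathbb{R}$ and $n\in\mathbb{N}$, the $n$th quantization error is $V_n(P)=\inf\{\int\min_{a\in\alpha}(x-a)^2\,dP(x) : \alpha\subset\mathbb{R},\ 1\le\mathrm{card}(\alpha)\le n\}$, and an optimal set of $n$-means for $P$ is a set $\alpha$ with $1\le\mathrm{card}(\alpha)\le n$ attaining this infimum (here it has exactly $n$ elements). $X$ is a random variable with distribution $P$, and $E(X:X\in[u,v])=\frac{1}{P([u,v])}\int_{[u,v]}x\,dP(x)$ is its conditional expectation given $X\in[u,v]$. $V1(k,m)$ denotes the $n$th quantization error when $\frac12(a_k+b_1)\le1$, and $V2(k,m)$ the $n$th quantization error when $1\le\frac12(a_k+b_1)$. *)

theory Defs
  imports "HOL-Probability.Probability"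
begin

definition mixture :: "real \<Rightarrow> 'a measure \<Rightarrow> 'a measure \<Rightarrow> 'a measure" where
  "mixture p M N = measure_of (space M) (sets M)
     (\<lambda>A. ennreal p * emeasure M A + ennreal (1 - p) * emeasure N A)"

lemma space_mixture [simp]: "space (mixture p M N) = space M"
  by (simp add: mixture_def space_measure_of_conv)

lemma sets_mixture [simp, measurable_cong]: "sets (mixture p M N) = sets M"
  by (simp add: mixture_def)

lemma emeasure_mixture:
  assumes sets_eq: "sets N = sets M" and A: "A \<in> sets M"
  shows "emeasure (mixture p M N) A = ennreal p * emeasure M A + ennreal (1 - p) * emeasure N A"
  unfolding mixture_def
proof (rule emeasure_measure_of_sigma[OF sets.sigma_algebra_axioms _ _ A])
  show "positive (sets M) (\<lambda>A. ennreal p * emeasure M A + ennreal (1 - p) * emeasure N A)"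
    by (simp add: positive_def)
  show "countably_additive (sets M)
      (\<lambda>A. ennreal p * emeasure M A + ennreal (1 - p) * emeasure N A)"
  proof (rule countably_additiveI)
    fix B :: "nat \<Rightarrow> 'a set"
    assume B: "range B \<subseteq> sets M" "disjoint_family B"
    have "(\<Sum>i. ennreal p * emeasure M (B i) + ennreal (1 - p) * emeasure N (B i))
        = ennreal p * (\<Sum>i. emeasure M (B i)) + ennreal (1 - p) * (\<Sum>i. emeasure N (B i))"
      by (simp add: suminf_add[symmetric] ennreal_suminf_cmult)
    also have "(\<Sum>i. emeasure M (B i)) = emeasure M (\<Union>i. B i)"
      using B by (rule suminf_emeasure)
    also have "(\<Sum>i. emeasure N (B i)) = emeasure N (\<Union>i. B i)"
      using B by (intro suminf_emeasure) (simp_all add: sets_eq)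
    finally show "(\<Sum>i. ennreal p * emeasure M (B i) + ennreal (1 - p) * emeasure N (B i))
        = ennreal p * emeasure M (\<Union>i. B i) + ennreal (1 - p) * emeasure N (\<Union>i. B i)" .
  qed
qed

lemma prob_space_mixture:
  assumes "prob_space M" "prob_space N" "sets N = sets M" "0 \<le> p" "p \<le> 1"
  shows "prob_space (mixture p M N)"
proof (rule prob_spaceI)
  have "space N = space M"
    using assms(3) by (rule sets_eq_imp_space_eq)
  then have "emeasure (mixture p M N) (space M) = ennreal p + ennreal (1 - p)"
    using assms prob_space.emeasure_space_1[of M] prob_space.emeasure_space_1[of N]
    by (simp add: emeasure_mixture)
  also have "\<dots> = 1"
    using assms by (simp flip: ennreal_plus)
  finally show "emeasure (mixture p M N) (space (mixture p M N)) = 1"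
    by simp
qed

definition distortion :: "real measure \<Rightarrow> real set \<Rightarrow> ennreal" where
  "distortion P \<alpha> = (\<integral>\<^sup>+ x. ennreal (Min ((\<lambda>a. (x - a)\<^sup>2) ` \<alpha>)) \<partial>P)"

text \<open>The condition \<open>1 \<le> card \<alpha>\<close> also makes \<open>\<alpha>\<close> finite, since infinite sets have cardinality 0.\<close>

definition quantization_error :: "nat \<Rightarrow> real measure \<Rightarrow> ennreal" where
  "quantization_error n P = (INF \<alpha>\<in>{\<alpha>. 1 \<le> card \<alpha> \<and> card \<alpha> \<le> n}. distortion P \<alpha>)"

definition optimal_set_of_means :: "nat \<Rightarrow> real measure \<Rightarrow> real set \<Rightarrow> bool" where
  "optimal_set_of_means n P \<alpha> \<longleftrightarrow>
     1 \<le> card \<alpha> \<and> card \<alpha> \<le> n \<and> distortion P \<alpha> = quantization_error n P"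

text \<open>\<open>E(X : X \<in> [u, v])\<close> for a random variable \<open>X\<close> with distribution \<open>P\<close>.\<close>

definition cond_mean :: "real measure \<Rightarrow> real \<Rightarrow> real \<Rightarrow> real" where
  "cond_mean P u v = 1 / measure P {u..v} * (LINT x:{u..v}|P. x)"

definition uniform_mixture :: "real \<Rightarrow> real measure" where
  "uniform_mixture p =
     mixture p (uniform_measure lborel {0..1}) (uniform_measure lborel {1..2})"

end

theory Submission
  imports Defs
begin

text \<open>
  Everything rests on the centroid condition: each point \<open>c\<close> of an optimal set is the conditional
  mean of \<open>P\<close> on its cell, the set of arguments for which \<open>c\<close> is a nearest point
  (\<open>optimal_imp_conditional_mean\<close>). This follows by comparison with a single competitor: if \<open>e\<close> is the
  conditional mean of the cell \<open>S\<close>, then replacing \<open>c\<close> by \<open>e\<close> lowers the distortion by at least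
  \<open>(c - e)\<^sup>2 P(S)\<close>, so optimality forces \<open>c = e\<close>.

  Write the optimal set as \<open>x\<^sub>1 < \<dots> < x\<^sub>n\<close>. On the support \<open>[0, 2]\<close> the cell of \<open>x\<^sub>j\<close> is the interval
  between consecutive ends \<open>c\<^sub>j\<^sub>-\<^sub>1\<close> and \<open>c\<^sub>j\<close>, where \<open>c\<^sub>0 = 0\<close>, \<open>c\<^sub>n = 2\<close> and the other ends are the
  midpoints of neighbouring points. Cells inside \<open>[0, 1]\<close> carry a constant density, so there the
  conditional mean is the midpoint of the cell. Thus points bisect cells and cell ends bisect the
  gaps between points; every half-cell has the same length \<open>h = x\<^sub>1\<close>, which gives
  \<open>x\<^sub>j = (2j - 1) h\<close> and \<open>c\<^sub>j = 2jh\<close> up to the last such cell (\<open>equally_spaced\<close>). If there are \<open>N\<close> of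
  these cells, then \<open>h = (x\<^sub>N + x\<^sub>N\<^sub>+\<^sub>1) / (4N)\<close>, and each cell contributes \<open>2h\<^sup>3/3\<close> to the integral of
  the squared distance (\<open>integral_sq_dist_left\<close>).

  The two cases of the proposition differ only in \<open>N\<close>. If \<open>(a\<^sub>k + b\<^sub>1)/2 \<le> 1\<close>, all \<open>k\<close> cells of the \<open>a\<^sub>j\<close>
  lie in \<open>[0, 1]\<close>, so \<open>N = k\<close>. If \<open>1 \<le> (a\<^sub>k + b\<^sub>1)/2\<close>, the cell of \<open>a\<^sub>k\<close> reaches \<open>1\<close> or beyond, while the cells before it
  stay in \<open>[0, 1]\<close> because \<open>a\<^sub>k\<^sub>-\<^sub>1 < a\<^sub>k \<le> 1\<close>; then \<open>N = k - 1\<close>. The quantization error is the distortion of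
  the optimal set, split at \<open>1\<close> and at the cell ends.
\<close>

section \<open>The squared distance to a finite set\<close>

definition sq_dist :: "real set \<Rightarrow> real \<Rightarrow> real" where
  "sq_dist \<alpha> t = Min ((\<lambda>c. (t - c)\<^sup>2) ` \<alpha>)"

lemma sq_dist_le: "finite \<alpha> \<Longrightarrow> c \<in> \<alpha> \<Longrightarrow> sq_dist \<alpha> t \<le> (t - c)\<^sup>2"
  by (simp add: sq_dist_def)

lemma sq_dist_nonneg: "finite \<alpha> \<Longrightarrow> \<alpha> \<noteq> {} \<Longrightarrow> 0 \<le> sq_dist \<alpha> t"
  by (simp add: sq_dist_def)

lemma sq_dist_attained: "finite \<alpha> \<Longrightarrow> \<alpha> \<noteq> {} \<Longrightarrow> \<exists>c\<in>\<alpha>. sq_dist \<alpha> t = (t - c)\<^sup>2"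
  using Min_in[of "(\<lambda>c. (t - c)\<^sup>2) ` \<alpha>"] unfolding sq_dist_def by blast

lemma sq_dist_eqI:
  assumes "finite \<alpha>" "c \<in> \<alpha>" "\<And>d. d \<in> \<alpha> \<Longrightarrow> (t - c)\<^sup>2 \<le> (t - d)\<^sup>2"
  shows "sq_dist \<alpha> t = (t - c)\<^sup>2"
  unfolding sq_dist_def using assms by (intro Min_eqI) auto

lemma continuous_on_sq_dist:
  assumes "finite \<alpha>" "\<alpha> \<noteq> {}"
  shows "continuous_on S (sq_dist \<alpha>)"
  using assms
proof (induction rule: finite_ne_induct)
  case (singleton c)
  then show ?case
    by (auto simp: sq_dist_def[abs_def] intro!: continuous_intros)
next
  case (insert c F)
  have "sq_dist (insert c F) = (\<lambda>t. min ((t - c)\<^sup>2) (sq_dist F t))"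
    using insert by (simp add: sq_dist_def fun_eq_iff)
  then show ?case
    using insert.IH by (auto intro!: continuous_intros)
qed

lemma borel_measurable_sq_dist:
  "finite \<alpha> \<Longrightarrow> \<alpha> \<noteq> {} \<Longrightarrow> sq_dist \<alpha> \<in> borel_measurable borel"
  by (intro borel_measurable_continuous_onI continuous_on_sq_dist)

section \<open>Points of an optimal set are conditional means\<close>

lemma (in real_distribution) integrable_square_shift:
  assumes "integrable M (\<lambda>t. t\<^sup>2)"
  shows "integrable M (\<lambda>t. t)" "integrable M (\<lambda>t. (t - c)\<^sup>2)"
proof -
  show 1: "integrable M (\<lambda>t. t)"
    using assms by (rule square_integrable_imp_integrable[rotated]) simp
  have "(\<lambda>t. (t - c)\<^sup>2) = (\<lambda>t. t\<^sup>2 - 2 * c * t + c\<^sup>2)"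
    by (auto simp: power2_eq_square algebra_simps)
  then show "integrable M (\<lambda>t. (t - c)\<^sup>2)"
    using assms 1 by simp
qed

lemma (in real_distribution) integrable_sq_dist:
  assumes "integrable M (\<lambda>t. t\<^sup>2)" "finite \<alpha>" "\<alpha> \<noteq> {}"
  shows "integrable M (sq_dist \<alpha>)"
proof -
  obtain c where c: "c \<in> \<alpha>"
    using assms by blast
  show ?thesis
  proof (rule Bochner_Integration.integrable_bound)
    show "integrable M (\<lambda>t. (t - c)\<^sup>2)"
      using assms(1) by (rule integrable_square_shift)
    show "sq_dist \<alpha> \<in> borel_measurable M"
      using borel_measurable_sq_dist assms(2,3) measurable_cong_sets[OF events_eq_borel refl]
      by blast
    show "AE t in M. norm (sq_dist \<alpha> t) \<le> norm ((t - c)\<^sup>2)"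
      using sq_dist_le[OF assms(2) c] sq_dist_nonneg[OF assms(2,3)] by simp
  qed
qed

lemma (in real_distribution) distortion_eq_integral:
  assumes "integrable M (\<lambda>t. t\<^sup>2)" "finite \<alpha>" "\<alpha> \<noteq> {}"
  shows "distortion M \<alpha> = ennreal (LINT t|M. sq_dist \<alpha> t)"
  unfolding distortion_def sq_dist_def[symmetric]
  using integrable_sq_dist[OF assms] sq_dist_nonneg[OF assms(2,3)]
  by (intro nn_integral_eq_integral) auto

text \<open>
  Let \<open>e\<close> be the conditional mean on the cell \<open>S\<close> of \<open>c\<close>, and move \<open>c\<close> to \<open>e\<close>. Almost everywhere outside \<open>S\<close> the
  squared distance does not grow, since some other point is at least as near as \<open>c\<close>. On \<open>S\<close> it falls by at
  least \<open>(t - c)\<^sup>2 - (t - e)\<^sup>2\<close>, which is affine in \<open>t\<close> and integrates to \<open>(e - c)\<^sup>2 prob S\<close>. An optimal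
  set admits no gain, so \<open>e = c\<close>.
\<close>

lemma (in real_distribution) optimal_imp_conditional_mean:
  assumes sq: "integrable M (\<lambda>t. t\<^sup>2)"
    and opt: "optimal_set_of_means n M \<alpha>"
    and c: "c \<in> \<alpha>"
    and S: "S \<in> sets borel" "prob S \<noteq> 0"
    and inside: "\<And>t d. t \<in> S \<Longrightarrow> d \<in> \<alpha> \<Longrightarrow> (t - c)\<^sup>2 \<le> (t - d)\<^sup>2"
    and outside: "AE t in M. t \<notin> S \<longrightarrow> (\<exists>d\<in>\<alpha> - {c}. (t - d)\<^sup>2 \<le> (t - c)\<^sup>2)"
  shows "c = (LINT t:S|M. t) / prob S"
proof -
  define e where "e = (LINT t:S|M. t) / prob S"
  define \<beta> where "\<beta> = insert e (\<alpha> - {c})"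
  have card: "1 \<le> card \<alpha>" "card \<alpha> \<le> n"
    and dist: "distortion M \<alpha> = quantization_error n M"
    using opt by (auto simp: optimal_set_of_means_def)
  have fin: "finite \<alpha>"
    using card card.infinite by fastforce
  have fin': "finite \<beta>" "\<beta> \<noteq> {}" and ne: "\<alpha> \<noteq> {}"
    using fin c by (auto simp: \<beta>_def)
  \<comment> \<open>The point \<open>e\<close> may already belong to \<open>\<alpha>\<close>, so the cardinality can drop.\<close>
  have "card \<beta> \<le> Suc (card (\<alpha> - {c}))"
    using fin by (simp add: \<beta>_def card_insert_if)
  also have "\<dots> = card \<alpha>"
    using fin c card by simp
  finally have "card \<beta> \<le> n" "1 \<le> card \<beta>"
    using card fin' by (auto simp: Suc_le_eq card_gt_0_iff)
  then have "distortion M \<alpha> \<le> distortion M \<beta>"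
    unfolding dist quantization_error_def by (intro INF_lower) simp
  then have le: "(LINT t|M. sq_dist \<alpha> t) \<le> (LINT t|M. sq_dist \<beta> t)"
    using sq fin ne fin' Bochner_Integration.integral_nonneg[of M "sq_dist \<beta>"] sq_dist_nonneg[OF fin']
    by (simp add: distortion_eq_integral ennreal_le_iff)
  have S': "S \<in> sets M"
    using S by simp
  have intS: "set_integrable M S (\<lambda>t. t)" "set_integrable M S (\<lambda>t. 1::real)"
    using integrable_mult_indicator[OF S' integrable_square_shift(1)[OF sq]]
      integrable_mult_indicator[OF S', of "\<lambda>_. 1::real"]
    by (simp_all add: set_integrable_def)
  have gain: "(t - c)\<^sup>2 - (t - e)\<^sup>2 = 2 * (e - c) * t + (c\<^sup>2 - e\<^sup>2)" for t
    by (simp add: power2_eq_square algebra_simps)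
  have gainS: "set_integrable M S (\<lambda>t. (t - c)\<^sup>2 - (t - e)\<^sup>2)"
    unfolding gain using intS set_integrable_mult_right[OF intS(2), of "c\<^sup>2 - e\<^sup>2"]
    by (intro set_integral_add set_integrable_mult_right) auto
  have "(LINT t|M. sq_dist \<beta> t) \<le>
        (LINT t|M. sq_dist \<alpha> t - indicator S t * ((t - c)\<^sup>2 - (t - e)\<^sup>2))"
  proof (rule integral_mono_AE)
    show "integrable M (sq_dist \<beta>)"
      using sq fin' by (rule integrable_sq_dist)
    show "integrable M (\<lambda>t. sq_dist \<alpha> t - indicator S t * ((t - c)\<^sup>2 - (t - e)\<^sup>2))"
      using integrable_sq_dist[OF sq fin ne] gainS by (simp add: set_integrable_def)
    show "AE t in M. sq_dist \<beta> t \<le> sq_dist \<alpha> t - indicator S t * ((t - c)\<^sup>2 - (t - e)\<^sup>2)"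
      using outside
    proof eventually_elim
      case (elim t)
      show ?case
      proof (cases "t \<in> S")
        case True
        then have "sq_dist \<alpha> t = (t - c)\<^sup>2"
          using inside c fin by (intro sq_dist_eqI) auto
        moreover have "sq_dist \<beta> t \<le> (t - e)\<^sup>2"
          using fin' by (intro sq_dist_le) (auto simp: \<beta>_def)
        ultimately show ?thesis
          using True by simp
      next
        case False
        obtain d where d: "d \<in> \<alpha>" "sq_dist \<alpha> t = (t - d)\<^sup>2"
          using sq_dist_attained[OF fin ne] by blast
        obtain d' where d': "d' \<in> \<alpha> - {c}" "(t - d')\<^sup>2 \<le> (t - c)\<^sup>2"
          using elim False by blast
        \<comment> \<open>If the nearest point is \<open>c\<close> itself, the competitor \<open>d'\<close> takes its place.\<close>
        have "\<exists>d''\<in>\<beta>. (t - d'')\<^sup>2 \<le> sq_dist \<alpha> t"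
          using d d' by (cases "d = c") (auto simp: \<beta>_def)
        then show ?thesis
          using False sq_dist_le[OF fin'(1)] by (fastforce intro: order_trans)
      qed
    qed
  qed
  also have "\<dots> = (LINT t|M. sq_dist \<alpha> t) - (LINT t:S|M. (t - c)\<^sup>2 - (t - e)\<^sup>2)"
    using integrable_sq_dist[OF sq fin ne] gainS
    by (simp add: set_integrable_def set_lebesgue_integral_def)
  finally have "(LINT t:S|M. (t - c)\<^sup>2 - (t - e)\<^sup>2) \<le> 0"
    using le by linarith
  also have "(LINT t:S|M. (t - c)\<^sup>2 - (t - e)\<^sup>2)
      = 2 * (e - c) * (LINT t:S|M. t) + (c\<^sup>2 - e\<^sup>2) * prob S"
    unfolding gain using intS set_integrable_mult_right[OF intS(2), of "c\<^sup>2 - e\<^sup>2"] S'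
    by (subst set_integral_add(2)) (auto simp: set_integral_const simp del: events_eq_borel)
  also have "(LINT t:S|M. t) = e * prob S"
    using S(2) by (simp add: e_def)
  also have "2 * (e - c) * (e * prob S) + (c\<^sup>2 - e\<^sup>2) * prob S = (e - c)\<^sup>2 * prob S"
    by (simp add: power2_eq_square algebra_simps)
  finally have "(e - c)\<^sup>2 \<le> 0"
    using S(2) by (simp add: mult_le_0_iff measure_le_0_iff)
  then show ?thesis
    by (simp add: e_def)
qed

section \<open>Integration against the mixture\<close>

text \<open>Both uniform densities count at the common end point \<open>1\<close>, a null set, so that the two pieces
  are closed intervals as in the integrals below.\<close>

definition mixture_density :: "real \<Rightarrow> real \<Rightarrow> real" where
  "mixture_density p t = p * indicator {0..1} t + (1 - p) * indicator {1..2} t"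

lemma mixture_density_measurable [measurable]: "mixture_density p \<in> borel_measurable borel"
  by (simp add: mixture_density_def[abs_def])

lemma uniform_mixture_eq_density:
  assumes "0 \<le> p" "p \<le> 1"
  shows "uniform_mixture p = density lborel (\<lambda>t. ennreal (mixture_density p t))"
proof (rule measure_eqI)
  fix A assume "A \<in> sets (uniform_mixture p)"
  then have A [measurable]: "A \<in> sets borel"
    by (simp add: uniform_mixture_def)
  have eq: "ennreal (mixture_density p t) * indicator A t
      = ennreal p * indicator ({0..1} \<inter> A) t + ennreal (1 - p) * indicator ({1..2} \<inter> A) t" for t
    using assms
    by (cases "t \<in> A"; cases "t \<in> {0..1}"; cases "t \<in> {1..2}")
      (auto simp: mixture_density_def simp flip: ennreal_plus)
  have "emeasure (density lborel (\<lambda>t. ennreal (mixture_density p t))) A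
      = ennreal p * emeasure lborel ({0..1} \<inter> A) + ennreal (1 - p) * emeasure lborel ({1..2} \<inter> A)"
    by (subst emeasure_density) (auto simp: eq nn_integral_add nn_integral_cmult)
  then show "emeasure (uniform_mixture p) A
      = emeasure (density lborel (\<lambda>t. ennreal (mixture_density p t))) A"
    by (simp add: uniform_mixture_def emeasure_mixture divide_ennreal_def)
qed (simp add: uniform_mixture_def)

lemma real_distribution_uniform_mixture:
  assumes "0 \<le> p" "p \<le> 1"
  shows "real_distribution (uniform_mixture p)"
proof -
  have "prob_space (uniform_mixture p)"
    unfolding uniform_mixture_def using assms
    by (intro prob_space_mixture prob_space_uniform_measure) auto
  then show ?thesis
    by (simp add: real_distribution_def real_distribution_axioms_def uniform_mixture_def)
qed

lemma AE_uniform_mixture: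
  assumes "0 \<le> p" "p \<le> 1"
  shows "AE t in uniform_mixture p. t \<in> {0..2}"
  unfolding uniform_mixture_eq_density[OF assms]
  by (subst AE_density) (auto simp: mixture_density_def indicator_def)

text \<open>The bridge from the measure to Henstock--Kurzweil integrals, in which the quantization error is
  expressed.\<close>

lemma set_integral_uniform_mixture:
  assumes "0 \<le> p" "p \<le> 1" "continuous_on UNIV f"
  shows "set_integrable (uniform_mixture p) {u..v} f"
    and "(LINT t:{u..v}|uniform_mixture p. f t)
      = p * integral ({u..v} \<inter> {0..1}) f + (1 - p) * integral ({u..v} \<inter> {1..2}) (f :: real \<Rightarrow> real)"
proof -
  have f [measurable]: "f \<in> borel_measurable borel"
    using assms(3) by (rule borel_measurable_continuous_onI)
  have nn: "0 \<le> mixture_density p t" for t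
    using assms by (simp add: mixture_density_def)
  have c: "continuous_on S f" for S
    using assms(3) continuous_on_subset by blast
  have int: "set_integrable lborel ({u..v} \<inter> {r..s}) f" for r s :: real
    by (simp add: borel_integrable_atLeastAtMost' c)
  have eq: "mixture_density p t * (indicator {u..v} t * f t)
      = p * (indicator ({u..v} \<inter> {0..1}) t * f t) + (1 - p) * (indicator ({u..v} \<inter> {1..2}) t * f t)" for t
    by (simp add: mixture_density_def indicator_inter_arith algebra_simps
        del: Int_atLeastAtMost)
  show "set_integrable (uniform_mixture p) {u..v} f"
    unfolding uniform_mixture_eq_density[OF assms(1,2)] set_integrable_def
    using int[of 0 1] int[of 1 2] nn
    by (subst integrable_density) (auto simp: eq set_integrable_def)
  have "(LINT t:{u..v}|uniform_mixture p. f t)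
      = p * (LINT t:{u..v} \<inter> {0..1}|lborel. f t) + (1 - p) * (LINT t:{u..v} \<inter> {1..2}|lborel. f t)"
    unfolding uniform_mixture_eq_density[OF assms(1,2)] set_lebesgue_integral_def
    using int[of 0 1] int[of 1 2] nn
    by (subst integral_density) (auto simp: eq set_integrable_def)
  then show "(LINT t:{u..v}|uniform_mixture p. f t)
      = p * integral ({u..v} \<inter> {0..1}) f + (1 - p) * integral ({u..v} \<inter> {1..2}) f"
    using int[of 0 1] int[of 1 2] by (simp add: set_borel_integral_eq_integral(2))
qed

lemma integral_uniform_mixture:
  assumes "0 \<le> p" "p \<le> 1" "continuous_on UNIV f"
  shows "integrable (uniform_mixture p) f"
    and "(LINT t|uniform_mixture p. f t)
      = p * integral {0..1} f + (1 - p) * integral {1..2} (f :: real \<Rightarrow> real)"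
proof -
  note [measurable] = borel_measurable_continuous_onI[OF assms(3)]
  have sets [measurable_cong]: "sets (uniform_mixture p) = sets borel"
    by (simp add: uniform_mixture_def)
  have ae: "AE t in uniform_mixture p. indicator {0..2} t *\<^sub>R f t = f t"
    using AE_uniform_mixture[OF assms(1,2)] by eventually_elim simp
  have m: "f \<in> borel_measurable (uniform_mixture p)"
       "(\<lambda>t. indicator {0..2} t *\<^sub>R f t) \<in> borel_measurable (uniform_mixture p)"
    by measurable
  show "integrable (uniform_mixture p) f"
    using set_integral_uniform_mixture(1)[OF assms, of 0 2] integrable_cong_AE[OF m(2,1) ae]
    by (simp add: set_integrable_def)
  have "(LINT t|uniform_mixture p. f t) = (LINT t:{0..2}|uniform_mixture p. f t)"
    unfolding set_lebesgue_integral_def using integral_cong_AE[OF m(2,1) ae] by simp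
  then show "(LINT t|uniform_mixture p. f t) = p * integral {0..1} f + (1 - p) * integral {1..2} f"
    using set_integral_uniform_mixture(2)[OF assms, of 0 2] by (simp add: Int_absorb1)
qed

lemma measure_uniform_mixture:
  assumes "0 \<le> p" "p \<le> 1"
  shows "measure (uniform_mixture p) {u..v}
    = p * measure lborel {max u 0..min v 1} + (1 - p) * measure lborel {max u 1..min v 2}"
proof -
  interpret real_distribution "uniform_mixture p"
    using assms by (rule real_distribution_uniform_mixture)
  have "measure (uniform_mixture p) {u..v} = (LINT t:{u..v}|uniform_mixture p. 1)"
    by (simp add: set_lebesgue_integral_def)
  then show ?thesis
    using set_integral_uniform_mixture(2)[OF assms, of "\<lambda>_. 1" u v] by simp
qed

lemma measure_uniform_mixture_pos:
  assumes "0 < p" "p < 1" "0 \<le> u" "u < v" "v \<le> 2"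
  shows "0 < measure (uniform_mixture p) {u..v}"
proof (cases "u < 1")
  case True
  then have "0 < measure lborel {max u 0..min v 1}"
    using assms by auto
  then show ?thesis
    using assms by (simp add: measure_uniform_mixture add_pos_nonneg)
next
  case False
  then have "0 < measure lborel {max u 1..min v 2}"
    using assms by auto
  then show ?thesis
    using assms by (simp add: measure_uniform_mixture add_nonneg_pos)
qed

lemma cond_mean_uniform_mixture_left:
  assumes "0 < p" "p < 1" "0 \<le> u" "u < v" "v \<le> 1"
  shows "cond_mean (uniform_mixture p) u v = (u + v) / 2"
proof -
  \<comment> \<open>The second intersection is empty or, when \<open>v = 1\<close>, a single point.\<close>
  have sub: "{u..v} \<inter> {0..1} = {u..v}" "integral ({u..v} \<inter> {1..2}) (\<lambda>t. t) = 0"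
    using assms by (cases "v < 1"; auto simp: max_def min_def)+
  have "integral {u..v} (\<lambda>t. t) = (v\<^sup>2 - u\<^sup>2) / 2"
    using assms ident_has_integral[of u v] by (simp add: integral_unique)
  then have "(LINT t:{u..v}|uniform_mixture p. t) = p * ((v\<^sup>2 - u\<^sup>2) / 2)"
    using assms sub by (subst set_integral_uniform_mixture(2)) auto
  moreover have "measure (uniform_mixture p) {u..v} = p * (v - u)"
    using assms by (simp add: measure_uniform_mixture max_def min_def)
  ultimately show ?thesis
    using assms square_diff_square_factored[of v u]
    by (simp add: cond_mean_def power2_eq_square)
qed

text \<open>The cells cut out of a uniform piece are all of this form, with \<open>c\<close> the point and \<open>h\<close> half
  the length of the cell.\<close>

lemma integral_square_centered:
  fixes c h :: real
  assumes "0 \<le> h"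
  shows "integral {c - h..c + h} (\<lambda>t. (t - c)\<^sup>2) = 2 * h ^ 3 / 3"
proof -
  have "((\<lambda>t. (t - c)\<^sup>2) has_integral ((c + h - c) ^ 3 / 3 - (c - h - c) ^ 3 / 3)) {c - h..c + h}"
    using assms
    by (intro fundamental_theorem_of_calculus)
      (auto intro!: derivative_eq_intros simp flip: has_real_derivative_iff_has_vector_derivative)
  then show ?thesis
    by (simp add: integral_unique)
qed

section \<open>The cells of an optimal set\<close>

locale optimal_points =
  fixes p :: real and n :: nat and \<alpha> :: "real set" and x :: "nat \<Rightarrow> real"
  assumes p: "0 < p" "p < 1"
    and n: "2 \<le> n"
    and mono: "strict_mono_on {1..n} x"
    and image: "\<alpha> = x ` {1..n}"
    and range: "\<alpha> \<subseteq> {0..2}"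
    and optimal: "optimal_set_of_means n (uniform_mixture p) \<alpha>"
begin

text \<open>The cell of \<open>x j\<close> is \<open>[cell_end (j - 1), cell_end j]\<close>. The outermost cells are cut off at the ends
  \<open>0\<close> and \<open>2\<close> of the support, so that every cell is a compact interval inside it.\<close>

definition cell_end :: "nat \<Rightarrow> real" where
  "cell_end j = (if j = 0 then 0 else if n \<le> j then 2 else (x j + x (Suc j)) / 2)"

lemma finite_points: "finite \<alpha>" "\<alpha> \<noteq> {}"
  using n by (auto simp: image)

lemma point_less: "1 \<le> i \<Longrightarrow> i < j \<Longrightarrow> j \<le> n \<Longrightarrow> x i < x j"
  using mono by (auto simp: strict_mono_on_def)

lemma point_bounds: "1 \<le> j \<Longrightarrow> j \<le> n \<Longrightarrow> 0 \<le> x j \<and> x j \<le> 2"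
  using range by (auto simp: image image_subset_iff)

lemma cell_end_pred: "2 \<le> j \<Longrightarrow> j \<le> n \<Longrightarrow> cell_end (j - 1) = (x (j - 1) + x j) / 2"
  by (cases j) (auto simp: cell_end_def)

lemma cell_end_less:
  assumes "i < j" "j \<le> n"
  shows "cell_end i < cell_end j"
  using assms
proof (induction j)
  case (Suc j)
  have "cell_end j < cell_end (Suc j)"
  proof (cases "j = 0")
    case True
    then show ?thesis
      using n point_less[of 1 2] point_bounds[of 1] by (auto simp: cell_end_def numeral_2_eq_2)
  next
    case False
    have "x j < x (Suc j)"
      using False Suc.prems by (intro point_less) auto
    moreover have "x (Suc j) < x (Suc (Suc j))" if "Suc j < n"
      using that by (intro point_less) auto
    moreover have "x (Suc j) \<le> 2"
      using point_bounds[of "Suc j"] Suc.prems by simp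
    ultimately show ?thesis
      using False Suc.prems by (auto simp: cell_end_def)
  qed
  then show ?case
    using Suc by (cases "i = j") auto
qed simp

lemma cell_end_bounds: "j \<le> n \<Longrightarrow> 0 \<le> cell_end j \<and> cell_end j \<le> 2"
  using cell_end_less[of 0 j] cell_end_less[of j n] n
  by (cases "j = 0"; cases "j = n") (auto simp: cell_end_def)

text \<open>By monotonicity of \<open>x\<close> the comparison with an arbitrary point reduces to the position of \<open>t\<close>
  relative to the midpoint with a neighbour, because
  \<open>(t - x i)\<^sup>2 - (t - x j)\<^sup>2 = (x j - x i) (2 t - x i - x j)\<close>.\<close>

lemma nearest_in_cell:
  assumes j: "1 \<le> j" "j \<le> n" and t: "t \<in> {cell_end (j - 1)..cell_end j}" and d: "d \<in> \<alpha>"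
  shows "(t - x j)\<^sup>2 \<le> (t - d)\<^sup>2"
proof -
  obtain i where i: "1 \<le> i" "i \<le> n" "d = x i"
    using d by (auto simp: image)
  have eq: "(t - d)\<^sup>2 - (t - x j)\<^sup>2 = (x j - x i) * (2 * t - x i - x j)"
    by (simp add: i power2_eq_square algebra_simps)
  consider "i < j" | "i = j" | "j < i"
    by linarith
  then have "0 \<le> (x j - x i) * (2 * t - x i - x j)"
  proof cases
    case 1
    then have "i = j - 1 \<or> i < j - 1"
      by linarith
    then have "x i \<le> x (j - 1)"
      using less_imp_le[OF point_less[of i "j - 1"]] i j by fastforce
    moreover have "cell_end (j - 1) = (x (j - 1) + x j) / 2"
      using 1 i j by (intro cell_end_pred) auto
    ultimately show ?thesis
      using point_less[of i j] 1 i j t by (intro mult_nonneg_nonneg) auto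
  next
    case 2
    then show ?thesis by simp
  next
    case 3
    then have "x (Suc j) \<le> x i"
      using point_less[of "Suc j" i] i j by (cases "i = Suc j") auto
    moreover have "cell_end j = (x j + x (Suc j)) / 2"
      using 3 i j by (simp add: cell_end_def)
    ultimately show ?thesis
      using point_less[of j i] 3 i j t by (intro mult_nonpos_nonpos) auto
  qed
  then show ?thesis
    using eq by linarith
qed

text \<open>The restriction to \<open>[0, 2]\<close> matters for \<open>x 1\<close> and \<open>x n\<close>: beyond the support they are
  the nearest points although their truncated cells do not extend there.\<close>

lemma other_point_outside_cell:
  assumes j: "1 \<le> j" "j \<le> n" and t: "t \<in> {0..2}" "t \<notin> {cell_end (j - 1)..cell_end j}"
  shows "\<exists>d\<in>\<alpha> - {x j}. (t - d)\<^sup>2 \<le> (t - x j)\<^sup>2"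
proof (cases "t < cell_end (j - 1)")
  case True
  then have j2: "2 \<le> j"
    using j t by (cases "j = 1") (auto simp: cell_end_def)
  have less: "x (j - 1) < x j"
    using j j2 by (intro point_less) auto
  have "(t - x j)\<^sup>2 - (t - x (j - 1))\<^sup>2 = (x j - x (j - 1)) * (x j + x (j - 1) - 2 * t)"
    by (simp add: power2_eq_square algebra_simps)
  moreover have "0 \<le> (x j - x (j - 1)) * (x j + x (j - 1) - 2 * t)"
    using True cell_end_pred[OF j2 j(2)] less by (intro mult_nonneg_nonneg) auto
  moreover have "x (j - 1) \<in> \<alpha>"
    unfolding image by (rule imageI) (use j j2 in auto)
  ultimately show ?thesis
    using less by (intro bexI[of _ "x (j - 1)"]) auto
next
  case False
  then have t': "cell_end j < t"
    using t by auto
  then have j2: "j < n"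
    using j t by (cases "j = n") (auto simp: cell_end_def)
  have less: "x j < x (Suc j)"
    using j j2 by (intro point_less) auto
  have "(t - x j)\<^sup>2 - (t - x (Suc j))\<^sup>2 = (x (Suc j) - x j) * (2 * t - x j - x (Suc j))"
    by (simp add: power2_eq_square algebra_simps)
  moreover have "0 \<le> (x (Suc j) - x j) * (2 * t - x j - x (Suc j))"
    using t' j j2 less by (intro mult_nonneg_nonneg) (auto simp: cell_end_def)
  moreover have "x (Suc j) \<in> \<alpha>"
    using j j2 by (auto simp: image)
  ultimately show ?thesis
    using less by (intro bexI[of _ "x (Suc j)"]) auto
qed

lemma point_eq_cond_mean:
  assumes j: "1 \<le> j" "j \<le> n"
  shows "x j = cond_mean (uniform_mixture p) (cell_end (j - 1)) (cell_end j)"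
proof -
  interpret real_distribution "uniform_mixture p"
    using p by (intro real_distribution_uniform_mixture) auto
  have "0 < prob {cell_end (j - 1)..cell_end j}"
    using j p cell_end_bounds[of "j - 1"] cell_end_bounds[of j] cell_end_less[of "j - 1" j]
    by (intro measure_uniform_mixture_pos) auto
  moreover have "AE t in uniform_mixture p. t \<notin> {cell_end (j - 1)..cell_end j} \<longrightarrow>
      (\<exists>d\<in>\<alpha> - {x j}. (t - d)\<^sup>2 \<le> (t - x j)\<^sup>2)"
    using AE_uniform_mixture[of p] p other_point_outside_cell[OF j] by auto
  moreover have "integrable (uniform_mixture p) (\<lambda>t. t\<^sup>2)"
    using p by (intro integral_uniform_mixture(1)) (auto intro!: continuous_intros)
  ultimately have "x j = (LINT t:{cell_end (j - 1)..cell_end j}|uniform_mixture p. t)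
      / prob {cell_end (j - 1)..cell_end j}"
    using optimal nearest_in_cell[OF j] j
    by (intro optimal_imp_conditional_mean) (auto simp: image)
  then show ?thesis
    by (simp add: cond_mean_def)
qed

lemma quantization_error_eq:
  "quantization_error n (uniform_mixture p)
    = ennreal (p * integral {0..1} (sq_dist \<alpha>) + (1 - p) * integral {1..2} (sq_dist \<alpha>))"
proof -
  interpret real_distribution "uniform_mixture p"
    using p by (intro real_distribution_uniform_mixture) auto
  have "integrable (uniform_mixture p) (\<lambda>t. t\<^sup>2)"
    using p by (intro integral_uniform_mixture(1)) (auto intro!: continuous_intros)
  then have "distortion (uniform_mixture p) \<alpha> = ennreal (LINT t|uniform_mixture p. sq_dist \<alpha> t)"
    using finite_points by (intro distortion_eq_integral)
  then show ?thesis
    using optimal p continuous_on_sq_dist[OF finite_points]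
    by (simp add: optimal_set_of_means_def integral_uniform_mixture(2))
qed

lemma integral_combine_sq_dist:
  "u \<le> v \<Longrightarrow> v \<le> w \<Longrightarrow>
    integral {u..v} (sq_dist \<alpha>) + integral {v..w} (sq_dist \<alpha>) = integral {u..w} (sq_dist \<alpha>)"
  by (rule Henstock_Kurzweil_Integration.integral_combine
      [OF _ _ integrable_continuous_real[OF continuous_on_sq_dist[OF finite_points]]])

lemma integral_sq_dist_in_cell:
  assumes "1 \<le> j" "j \<le> n" "cell_end (j - 1) \<le> u" "v \<le> cell_end j"
  shows "integral {u..v} (sq_dist \<alpha>) = integral {u..v} (\<lambda>t. (t - x j)\<^sup>2)"
  using assms finite_points nearest_in_cell[OF assms(1,2)]
  by (intro Henstock_Kurzweil_Integration.integral_cong sq_dist_eqI) (auto simp: image)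

section \<open>Cells contained in the left interval\<close>

text \<open>Two reflections alternate: \<open>x j\<close> is the midpoint of its cell, by the centroid condition for a
  constant density, and \<open>cell_end j\<close> is the midpoint of \<open>x j\<close> and \<open>x (Suc j)\<close>, by definition. Starting
  from \<open>cell_end 0 = 0\<close> each reflection moves on by \<open>x 1\<close>.\<close>

lemma equally_spaced:
  assumes N: "N < n" "cell_end N \<le> 1" and j: "1 \<le> j" "j \<le> N"
  shows "x j = (2 * real j - 1) * x 1" "cell_end j = 2 * real j * x 1"
proof -
  have mid: "x i = (cell_end (i - 1) + cell_end i) / 2" if "1 \<le> i" "i \<le> N" for i
  proof -
    have "cell_end i \<le> 1"
      using that N cell_end_less[of i N] by (cases "i = N") auto
    then have "cond_mean (uniform_mixture p) (cell_end (i - 1)) (cell_end i)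
        = (cell_end (i - 1) + cell_end i) / 2"
      using that N p cell_end_less[of "i - 1" i] cell_end_bounds[of "i - 1"]
      by (intro cond_mean_uniform_mixture_left) auto
    then show ?thesis
      using that N point_eq_cond_mean[of i] by simp
  qed
  have "x j = (2 * real j - 1) * x 1 \<and> cell_end j = 2 * real j * x 1"
    using j
  proof (induction j rule: nat_induct_at_least)
    case base
    then show ?case
      using mid[of 1] by (simp add: cell_end_def[of 0])
  next
    case (Suc j)
    have "cell_end j = (x j + x (Suc j)) / 2"
      using Suc.hyps Suc.prems N by (simp add: cell_end_def)
    then have "x (Suc j) = 2 * cell_end j - x j"
      by simp
    then have 1: "x (Suc j) = (2 * real (Suc j) - 1) * x 1"
      using Suc by (simp add: algebra_simps)
    have "cell_end (Suc j) = 2 * x (Suc j) - cell_end j"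
      using mid[of "Suc j"] Suc by simp
    then show ?case
      using 1 Suc by (simp add: algebra_simps)
  qed
  then show "x j = (2 * real j - 1) * x 1" "cell_end j = 2 * real j * x 1"
    by auto
qed

lemma first_point_eq:
  assumes "1 \<le> N" "N < n" "cell_end N \<le> 1"
  shows "x 1 = (x N + x (Suc N)) / (4 * real N)"
  using equally_spaced(2)[OF assms(2,3,1) order_refl] assms by (simp add: cell_end_def field_simps)

text \<open>Each of the \<open>N\<close> cells contributes \<open>2 h\<^sup>3/3\<close> with \<open>h = x 1 = (x N + x (Suc N)) / (4 N)\<close>; the constant
  is \<open>96 = 64 * 3 / 2\<close>.\<close>

lemma integral_sq_dist_left:
  assumes N: "N < n" "cell_end N \<le> 1" and "1 \<le> N"
  shows "integral {0..cell_end N} (sq_dist \<alpha>) = (x N + x (Suc N)) ^ 3 / (96 * (real N)\<^sup>2)"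
proof -
  have "integral {0..cell_end j} (sq_dist \<alpha>) = real j * (2 * x 1 ^ 3 / 3)" if "j \<le> N" for j
    using that
  proof (induction j)
    case 0
    then show ?case by (simp add: cell_end_def)
  next
    case (Suc j)
    have e: "cell_end j = 2 * real j * x 1"
      using equally_spaced(2)[OF N, of j] Suc.prems by (cases "j = 0") (auto simp: cell_end_def)
    have cell: "cell_end j = x (Suc j) - x 1" "cell_end (Suc j) = x (Suc j) + x 1"
      using e equally_spaced[OF N, of "Suc j"] Suc.prems by (simp_all add: algebra_simps)
    have "integral {cell_end j..cell_end (Suc j)} (sq_dist \<alpha>)
        = integral {cell_end j..cell_end (Suc j)} (\<lambda>t. (t - x (Suc j))\<^sup>2)"
      using Suc.prems N by (intro integral_sq_dist_in_cell) auto
    also have "\<dots> = 2 * x 1 ^ 3 / 3"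
      unfolding cell using point_bounds[of 1] n by (intro integral_square_centered) auto
    finally have "integral {cell_end j..cell_end (Suc j)} (sq_dist \<alpha>) = 2 * x 1 ^ 3 / 3" .
    moreover have "integral {0..cell_end j} (sq_dist \<alpha>)
        + integral {cell_end j..cell_end (Suc j)} (sq_dist \<alpha>) = integral {0..cell_end (Suc j)} (sq_dist \<alpha>)"
      using Suc.prems N cell_end_bounds[of j] cell_end_less[of j "Suc j"]
      by (intro integral_combine_sq_dist) auto
    ultimately show ?case
      using Suc by (simp add: algebra_simps)
  qed
  then have "integral {0..cell_end N} (sq_dist \<alpha>) = real N * (2 * x 1 ^ 3 / 3)"
    by simp
  also have "\<dots> = (x N + x (Suc N)) ^ 3 / (96 * (real N)\<^sup>2)"
    unfolding first_point_eq[OF assms(3) N]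
    using assms(3) by (simp add: power_divide field_simps power2_eq_square power3_eq_cube)
  finally show ?thesis .
qed

end

section \<open>One point in the right interval\<close>

theorem proposition2p5:
  fixes p :: real and P :: "real measure" and n k m :: nat
    and \<alpha> :: "real set" and a b :: "nat \<Rightarrow> real"
  assumes "0 < p" and "p < 1"
    and "P = uniform_mixture p"
    and "n \<ge> 3"
    and "optimal_set_of_means n P \<alpha>"
    and "\<alpha> \<inter> {0..1} \<noteq> {}" and "\<alpha> \<inter> {1<..2} \<noteq> {}"
    and "strict_mono_on {1..k} a" and "\<alpha> \<inter> {0..1} = a ` {1..k}"
    and "strict_mono_on {1..m} b" and "\<alpha> \<inter> {1<..2} = b ` {1..m}"
    and "k + m = n"
    and "k \<ge> 2" and "m = 1"
  shows "((a k + b 1) / 2 \<le> 1 \<longrightarrow>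
            (\<forall>j\<in>{1..k}. a j = (2 * real j - 1) * (a k + b 1) / (4 * real k))
          \<and> b 1 = cond_mean P ((a k + b 1) / 2) 2
          \<and> quantization_error n P = ennreal
              (p * ((a k + b 1) ^ 3 / (96 * (real k)\<^sup>2))
             + p * integral {(a k + b 1) / 2..1} (\<lambda>x. (x - b 1)\<^sup>2)
             + (1 - p) * integral {1..2} (\<lambda>x. (x - b 1)\<^sup>2)))
       \<and> (1 \<le> (a k + b 1) / 2 \<longrightarrow>
            (\<forall>j\<in>{1..k - 1}. a j = (2 * real j - 1) * (a (k - 1) + a k) / (4 * (real k - 1)))
          \<and> a k = cond_mean P ((a (k - 1) + a k) / 2) ((a k + b 1) / 2)
          \<and> b 1 = cond_mean P ((a k + b 1) / 2) 2
          \<and> quantization_error n P = ennreal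
              (p * ((a (k - 1) + a k) ^ 3 / (96 * (real k - 1)\<^sup>2))
             + p * integral {(a (k - 1) + a k) / 2..1} (\<lambda>x. (x - a k)\<^sup>2)
             + (1 - p) * integral {1..(a k + b 1) / 2} (\<lambda>x. (x - a k)\<^sup>2)
             + (1 - p) * integral {(a k + b 1) / 2..2} (\<lambda>x. (x - b 1)\<^sup>2)))"
proof -
  \<comment> \<open>The optimal set in increasing order: the \<open>a\<close>'s are followed by \<open>b 1\<close>.\<close>
  define x where "x j = (if j \<le> k then a j else b 1)" for j
  have n_eq: "n = Suc k" and k: "2 \<le> k"
    using assms by auto
  have a_img: "\<alpha> \<inter> {0..1} = a ` {1..k}" and b_img: "\<alpha> \<inter> {1<..2} = {b 1}"
    using assms by auto
  have a_range: "0 \<le> a j \<and> a j \<le> 1" if "1 \<le> j" "j \<le> k" for j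
    using a_img that by (metis IntD2 atLeastAtMost_iff imageI)
  have b_range: "1 < b 1" "b 1 \<le> 2"
    using b_img by auto
  have a_less: "a i < a j" if "1 \<le> i" "i < j" "j \<le> k" for i j
    using assms(8) that by (auto simp: strict_mono_on_def)
  have mono: "strict_mono_on {1..n} x"
  proof (rule strict_mono_onI)
    fix i j assume "i \<in> {1..n}" "j \<in> {1..n}" "i < j"
    then show "x i < x j"
      using a_less[of i j] a_range[of i] b_range by (auto simp: x_def n_eq)
  qed
  have opt: "optimal_set_of_means n (uniform_mixture p) \<alpha>"
    using assms by simp
  have "x ` {1..n} = insert (b 1) (a ` {1..k})"
    by (auto simp: x_def n_eq atLeastAtMostSuc_conv image_def)
  also have "\<dots> = \<alpha> \<inter> {1<..2} \<union> \<alpha> \<inter> {0..1}"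
    by (simp only: a_img b_img insert_is_Un[of _ "a ` {1..k}"])
  also have "\<dots> = \<alpha> \<inter> {0..2}"
    by auto
  finally have sub: "x ` {1..n} = \<alpha> \<inter> {0..2}" .
  \<comment> \<open>The \<open>n\<close> points in \<open>[0, 2]\<close> exhaust the cardinality bound, so no point lies outside.\<close>
  have "card (x ` {1..n}) = n"
    using strict_mono_on_imp_inj_on[OF mono] by (simp add: card_image)
  moreover have "card \<alpha> \<le> n" "finite \<alpha>"
    using opt card.infinite[of \<alpha>] by (fastforce simp: optimal_set_of_means_def)+
  ultimately have img: "\<alpha> = x ` {1..n}"
    using card_seteq[of \<alpha> "x ` {1..n}"] unfolding sub by simp
  have range: "\<alpha> \<subseteq> {0..2}"
    using img sub by blast
  interpret optimal_points p "Suc k" \<alpha> x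
    using assms(1,2,4) mono img range opt unfolding n_eq by unfold_locales (assumption | simp)+
  have x: "x (k - 1) = a (k - 1)" "x k = a k" "x (Suc k) = b 1"
    by (auto simp: x_def)
  have c: "cell_end (k - 1) = (a (k - 1) + a k) / 2" "cell_end k = (a k + b 1) / 2"
      "cell_end (Suc k) = 2"
    using k x by (auto simp: cell_end_def)
  have "a (k - 1) < a k"
    using k by (intro a_less) auto
  then have ck: "cell_end (k - 1) \<le> 1"
    using c(1) a_range[of k] k by simp
  have c2: "0 \<le> cell_end (k - 1)" "0 \<le> cell_end k" "cell_end k \<le> 2"
    using cell_end_bounds[of "k - 1"] cell_end_bounds[of k] by auto
  have b_mean: "b 1 = cond_mean P ((a k + b 1) / 2) 2"
    using point_eq_cond_mean[of "Suc k"] assms(3) c x by simp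
  have "(\<forall>j\<in>{1..k}. a j = (2 * real j - 1) * (a k + b 1) / (4 * real k))
      \<and> quantization_error n P = ennreal
              (p * ((a k + b 1) ^ 3 / (96 * (real k)\<^sup>2))
             + p * integral {(a k + b 1) / 2..1} (\<lambda>x. (x - b 1)\<^sup>2)
             + (1 - p) * integral {1..2} (\<lambda>x. (x - b 1)\<^sup>2))"
    if le: "(a k + b 1) / 2 \<le> 1"
  proof
    have le': "cell_end k \<le> 1"
      using le c by simp
    show "\<forall>j\<in>{1..k}. a j = (2 * real j - 1) * (a k + b 1) / (4 * real k)"
    proof
      fix j assume j: "j \<in> {1..k}"
      have "x j = (2 * real j - 1) * x 1"
        using j le' by (intro equally_spaced(1)[of k]) auto
      also have "x 1 = (a k + b 1) / (4 * real k)"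
        using first_point_eq[of k] le' k x by simp
      finally show "a j = (2 * real j - 1) * (a k + b 1) / (4 * real k)"
        using j by (auto simp: x_def split: if_splits)
    qed
    have "integral {0..1} (sq_dist \<alpha>)
        = integral {0..cell_end k} (sq_dist \<alpha>) + integral {cell_end k..1} (sq_dist \<alpha>)"
      using integral_combine_sq_dist[of 0 "cell_end k" 1] c2 le' by simp
    also have "integral {0..cell_end k} (sq_dist \<alpha>) = (a k + b 1) ^ 3 / (96 * (real k)\<^sup>2)"
      using integral_sq_dist_left[of k] le' k x by simp
    also have "integral {cell_end k..1} (sq_dist \<alpha>) = integral {cell_end k..1} (\<lambda>t. (t - b 1)\<^sup>2)"
      unfolding x(3)[symmetric]
        by (intro integral_sq_dist_in_cell) (auto simp: c)
    finally have 1: "integral {0..1} (sq_dist \<alpha>) = (a k + b 1) ^ 3 / (96 * (real k)\<^sup>2)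
        + integral {(a k + b 1) / 2..1} (\<lambda>t. (t - b 1)\<^sup>2)"
      by (simp only: c)
    have 2: "integral {1..2} (sq_dist \<alpha>) = integral {1..2} (\<lambda>t. (t - b 1)\<^sup>2)"
      unfolding x(3)[symmetric] using le
        by (intro integral_sq_dist_in_cell) (auto simp: c)
    show "quantization_error n P = ennreal
              (p * ((a k + b 1) ^ 3 / (96 * (real k)\<^sup>2))
             + p * integral {(a k + b 1) / 2..1} (\<lambda>x. (x - b 1)\<^sup>2)
             + (1 - p) * integral {1..2} (\<lambda>x. (x - b 1)\<^sup>2))"
      unfolding assms(3) n_eq quantization_error_eq 1 2 by (simp only: distrib_left)
  qed
  moreover have "(\<forall>j\<in>{1..k - 1}. a j = (2 * real j - 1) * (a (k - 1) + a k) / (4 * (real k - 1)))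
      \<and> a k = cond_mean P ((a (k - 1) + a k) / 2) ((a k + b 1) / 2)
      \<and> quantization_error n P = ennreal
              (p * ((a (k - 1) + a k) ^ 3 / (96 * (real k - 1)\<^sup>2))
             + p * integral {(a (k - 1) + a k) / 2..1} (\<lambda>x. (x - a k)\<^sup>2)
             + (1 - p) * integral {1..(a k + b 1) / 2} (\<lambda>x. (x - a k)\<^sup>2)
             + (1 - p) * integral {(a k + b 1) / 2..2} (\<lambda>x. (x - b 1)\<^sup>2))"
    if ge: "1 \<le> (a k + b 1) / 2"
  proof (intro conjI)
    have ge': "1 \<le> cell_end k"
      using ge by (simp only: c)
    have k1: "real (k - 1) = real k - 1" "Suc (k - 1) = k"
      using k by auto
    show "\<forall>j\<in>{1..k - 1}. a j = (2 * real j - 1) * (a (k - 1) + a k) / (4 * (real k - 1))"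
    proof
      fix j assume j: "j \<in> {1..k - 1}"
      have "x j = (2 * real j - 1) * x 1"
        using j ck by (intro equally_spaced(1)[of "k - 1"]) auto
      also have "x 1 = (a (k - 1) + a k) / (4 * (real k - 1))"
        using first_point_eq[of "k - 1"] ck k x k1 by simp
      finally show "a j = (2 * real j - 1) * (a (k - 1) + a k) / (4 * (real k - 1))"
        using j by (auto simp: x_def split: if_splits)
    qed
    show "a k = cond_mean P ((a (k - 1) + a k) / 2) ((a k + b 1) / 2)"
      unfolding assms(3) by (rule point_eq_cond_mean[of k, unfolded x c]) (use k in auto)
    have "integral {0..1} (sq_dist \<alpha>)
        = integral {0..cell_end (k - 1)} (sq_dist \<alpha>) + integral {cell_end (k - 1)..1} (sq_dist \<alpha>)"
      using integral_combine_sq_dist[of 0 "cell_end (k - 1)" 1] c2 ck by simp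
    also have "integral {0..cell_end (k - 1)} (sq_dist \<alpha>)
        = (a (k - 1) + a k) ^ 3 / (96 * (real k - 1)\<^sup>2)"
      using integral_sq_dist_left[of "k - 1"] ck k x k1 by simp
    also have "integral {cell_end (k - 1)..1} (sq_dist \<alpha>)
        = integral {cell_end (k - 1)..1} (\<lambda>t. (t - a k)\<^sup>2)"
      unfolding x(2)[symmetric] using ge k
        by (intro integral_sq_dist_in_cell) (auto simp: c)
    finally have 1: "integral {0..1} (sq_dist \<alpha>) = (a (k - 1) + a k) ^ 3 / (96 * (real k - 1)\<^sup>2)
        + integral {(a (k - 1) + a k) / 2..1} (\<lambda>t. (t - a k)\<^sup>2)"
      by (simp only: c)
    have "integral {1..2} (sq_dist \<alpha>)
        = integral {1..cell_end k} (sq_dist \<alpha>) + integral {cell_end k..2} (sq_dist \<alpha>)"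
      using integral_combine_sq_dist[of 1 "cell_end k" 2] c2 ge' by simp
    also have "integral {1..cell_end k} (sq_dist \<alpha>) = integral {1..cell_end k} (\<lambda>t. (t - a k)\<^sup>2)"
      unfolding x(2)[symmetric] using ck k
        by (intro integral_sq_dist_in_cell) (auto simp: c)
    also have "integral {cell_end k..2} (sq_dist \<alpha>) = integral {cell_end k..2} (\<lambda>t. (t - b 1)\<^sup>2)"
      unfolding x(3)[symmetric]
        by (intro integral_sq_dist_in_cell) (auto simp: c)
    finally have 2: "integral {1..2} (sq_dist \<alpha>) = integral {1..(a k + b 1) / 2} (\<lambda>t. (t - a k)\<^sup>2)
        + integral {(a k + b 1) / 2..2} (\<lambda>t. (t - b 1)\<^sup>2)"
      by (simp only: c)
    show "quantization_error n P = ennreal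
              (p * ((a (k - 1) + a k) ^ 3 / (96 * (real k - 1)\<^sup>2))
             + p * integral {(a (k - 1) + a k) / 2..1} (\<lambda>x. (x - a k)\<^sup>2)
             + (1 - p) * integral {1..(a k + b 1) / 2} (\<lambda>x. (x - a k)\<^sup>2)
             + (1 - p) * integral {(a k + b 1) / 2..2} (\<lambda>x. (x - b 1)\<^sup>2))"
      unfolding assms(3) n_eq quantization_error_eq 1 2 by (simp only: distrib_left add.assoc)
  qed
  ultimately show ?thesis
    using b_mean by blast
qed

end
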